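(* For all real parameters $c_1>0$, $c_2>0$, $k_1>0$, $k_2>0$, the map $G$ (the Bertrand duopoly map for $\alpha=1/3$, defined in the context) has exactly one equilibrium $(p_1,p_2)$ with $p_1>0$ and $p_2>0$, i.e. there is exactly one pair $(p_1,p_2)$ of positive reals with $G(p_1,p_2)=(p_1,p_2)$.
   Context: For $\alpha=1/3$ (so $\beta=\alpha/(1-\alpha)=1/2$) the dynamic Bertrand duopoly game with differentiated products is the iteration $(p_1(t+1),p_2(t+1))=G(p_1(t),p_2(t))$ with $$G(p_1,p_2)=\left(p_1+k_1\frac{-p_1\sqrt{p_1p_2}+(2p_2+3\sqrt{p_1p_2})c_1}{2p_1^2(\sqrt{p_1}+\sqrt{p_2})^2},\;\; p_2+k_2\frac{-p_2\sqrt{p_1p_2}+(2p_1+3\sqrt{p_1p_2})c_2}{2p_2^2(\sqrt{p_1}+\sqrt{p_2})^2}\right),\qquad p_1,p_2>0.$$ Here $p_i$ is the price set by firm $i$, $c_i>0$ is its marginal cost, and $k_i>0$ is its adjustment speed. An equilibrium is a fixed point of $G$. *)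

theory Defs
  imports Complex_Main
begin

(* Only the values on the open positive quadrant are meaningful; elsewhere the map takes
   whatever values sqrt and division by zero happen to give. *)
definition bertrand_map :: "real \<Rightarrow> real \<Rightarrow> real \<Rightarrow> real \<Rightarrow> real \<times> real \<Rightarrow> real \<times> real" where
  "bertrand_map c1 c2 k1 k2 = (\<lambda>(p1, p2).
    (p1 + k1 * ((- p1 * sqrt (p1 * p2) + (2 * p2 + 3 * sqrt (p1 * p2)) * c1)
               / (2 * p1 ^ 2 * (sqrt p1 + sqrt p2) ^ 2)),
     p2 + k2 * ((- p2 * sqrt (p1 * p2) + (2 * p1 + 3 * sqrt (p1 * p2)) * c2)
               / (2 * p2 ^ 2 * (sqrt p1 + sqrt p2) ^ 2))))"

end

theory Submission
  imports Defs
begin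

text \<open>With \<open>x = sqrt p1\<close>, \<open>y = sqrt p2\<close> the fixed point equations become
  \<open>x\<^sup>2 = c1 (2 y/x + 3)\<close> and \<open>y\<^sup>2 = c2 (2 x/y + 3)\<close>. So \<open>x\<close> increases and \<open>y\<close> decreases with
  the ratio \<open>t = y/x\<close>, and two solutions cannot have different ratios. The ratio of a solution
  is a root of \<open>c1 t\<^sup>3 (2 t + 3) = c2 (3 t + 2)\<close>, which exists by the intermediate value theorem.\<close>

text \<open>After the square-root substitution each numerator factors as
  \<open>a * b * (c * (2 * (b / a) + 3) - a\<^sup>2)\<close>, and only the last factor can
  vanish.\<close>

lemma bertrand_map_fixed_iff:
  fixes x y :: real
  assumes "x > 0" "y > 0" "k1 > 0" "k2 > 0"
  shows "bertrand_map c1 c2 k1 k2 (x\<^sup>2, y\<^sup>2) = (x\<^sup>2, y\<^sup>2) \<longleftrightarrow>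
    x\<^sup>2 = c1 * (2 * (y / x) + 3) \<and> y\<^sup>2 = c2 * (2 * (x / y) + 3)"
proof -
  have sqrts: "sqrt (x\<^sup>2 * y\<^sup>2) = x * y" "sqrt (x\<^sup>2) = x" "sqrt (y\<^sup>2) = y"
    using assms by (simp_all add: real_sqrt_mult)
  \<comment> \<open>Serves both coordinates: \<open>a\<close> and \<open>b\<close> get swapped,
    while \<open>x + y\<close> is symmetric.\<close>
  have step: "a\<^sup>2 + k * ((- a\<^sup>2 * (a * b) + (2 * b\<^sup>2 + 3 * (a * b)) * c) / (2 * (a\<^sup>2)\<^sup>2 * (x + y)\<^sup>2))
      = a\<^sup>2 \<longleftrightarrow> a\<^sup>2 = c * (2 * (b / a) + 3)"
    if "a > 0" "b > 0" "k > 0" for a b c k :: real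
  proof -
    have "- a\<^sup>2 * (a * b) + (2 * b\<^sup>2 + 3 * (a * b)) * c = a * b * (c * (2 * (b / a) + 3) - a\<^sup>2)"
      using that by (simp add: field_simps power2_eq_square)
    then show ?thesis
      using that assms by auto
  qed
  show ?thesis
    unfolding bertrand_map_def prod.case prod.inject sqrts
    using step[of x y k1 c1] step[of y x k2 c2] assms by (simp add: mult.commute)
qed

text \<open>One inequality suffices: the hypotheses are symmetric in the two solutions, so
  exchanging them gives the converse.\<close>

lemma ratio_le:
  fixes x y x' y' c1 c2 :: real
  assumes pos: "x > 0" "y > 0" "x' > 0" "y' > 0" "c1 > 0" "c2 > 0"
    and "x\<^sup>2 = c1 * (2 * (y / x) + 3)" "y\<^sup>2 = c2 * (2 * (x / y) + 3)"
    and "x'\<^sup>2 = c1 * (2 * (y' / x') + 3)" "y'\<^sup>2 = c2 * (2 * (x' / y') + 3)"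
  shows "y' / x' \<le> y / x"
proof (rule ccontr)
  assume "\<not> y' / x' \<le> y / x"
  then have less: "y / x < y' / x'" by simp
  then have "x' / y' < x / y"
    using pos by (simp add: field_simps)
  with less have "x\<^sup>2 < x'\<^sup>2" "y'\<^sup>2 < y\<^sup>2"
    using assms by simp_all
  then have "x < x'" "y' < y"
    using pos by (auto intro: power2_less_imp_less)
  then have "y' / x' < y / x"
    using pos by (intro frac_less) auto
  with less show False by simp
qed

lemma exists_ratio:
  fixes c1 c2 :: real
  assumes "c1 > 0" "c2 > 0"
  shows "\<exists>t>0. c1 * t ^ 3 * (2 * t + 3) = c2 * (3 * t + 2)"
proof -
  define h where "h t = c1 * t ^ 3 * (2 * t + 3) - c2 * (3 * t + 2)" for t
  \<comment> \<open>Large enough for two bounds whose product is \<open>h T \<ge> 0\<close>: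
    \<open>c2 \<le> c1 * T\<close>, and \<open>3 * T + 2 \<le> T\<^sup>2 * (2 * T + 3)\<close> from
    \<open>T \<ge> 1\<close>.\<close>
  define T where "T = 1 + c2 / c1"
  have T: "T \<ge> 1" "c2 \<le> c1 * T"
    using assms by (simp_all add: T_def field_simps)
  have "1 * (3 * T + 2) \<le> T * (2 * T + 3)"
    using T mult_mono[of 1 T 1 T] by (simp add: algebra_simps)
  also have "\<dots> \<le> T\<^sup>2 * (2 * T + 3)"
    using T by (intro mult_right_mono) (simp_all add: power2_eq_square)
  finally have "c2 * (3 * T + 2) \<le> c1 * T * (T\<^sup>2 * (2 * T + 3))"
    using T assms by (intro mult_mono) auto
  then have "h T \<ge> 0"
    by (simp add: h_def power2_eq_square power3_eq_cube mult.assoc)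
  moreover have h0: "h 0 < 0"
    using assms by (simp add: h_def)
  moreover have "continuous_on {0..T} h"
    unfolding h_def by (intro continuous_intros)
  ultimately obtain t where "0 \<le> t" "h t = 0"
    using IVT'[of h 0 0 T] T by auto
  then show ?thesis
    \<comment> \<open>Strict negativity of \<open>h 0\<close> rules out the root
      \<open>t = 0\<close>.\<close>
    using h0 by (intro exI[of _ t]) (auto simp: h_def less_le)
qed

theorem proposition3:
  fixes c1 c2 k1 k2 :: real
  assumes "c1 > 0" "c2 > 0" "k1 > 0" "k2 > 0"
  shows "\<exists>!p. p \<in> {0<..} \<times> {0<..} \<and> bertrand_map c1 c2 k1 k2 p = p"
proof (rule ex_ex1I)
  obtain t where t: "t > 0" "c1 * t ^ 3 * (2 * t + 3) = c2 * (3 * t + 2)"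
    using exists_ratio assms by blast
  \<comment> \<open>Solves the first equation with \<open>y = t * x\<close>; the second is then the
    equation for \<open>t\<close> divided by \<open>t\<close>.\<close>
  define x where "x = sqrt (c1 * (2 * t + 3))"
  have x: "x > 0" "x\<^sup>2 = c1 * (2 * t + 3)"
    using t assms by (simp_all add: x_def)
  have "(t * x)\<^sup>2 = t\<^sup>2 * (c1 * (2 * t + 3))"
    by (simp add: power_mult_distrib x)
  also have "\<dots> = c2 * (2 * (1 / t) + 3)"
    using t by (simp add: field_simps power2_eq_square power3_eq_cube)
  finally have "(t * x)\<^sup>2 = c2 * (2 * (1 / t) + 3)" .
  then have "bertrand_map c1 c2 k1 k2 (x\<^sup>2, (t * x)\<^sup>2) = (x\<^sup>2, (t * x)\<^sup>2)"
    using x t assms by (subst bertrand_map_fixed_iff) simp_all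
  then show "\<exists>p. p \<in> {0<..} \<times> {0<..} \<and> bertrand_map c1 c2 k1 k2 p = p"
    using x(1) t(1) by (intro exI[of _ "(x\<^sup>2, (t * x)\<^sup>2)"]) simp
next
  have sqrt_form: "\<exists>x y. x > 0 \<and> y > 0 \<and> p = (x\<^sup>2, y\<^sup>2) \<and>
      x\<^sup>2 = c1 * (2 * (y / x) + 3) \<and> y\<^sup>2 = c2 * (2 * (x / y) + 3)"
    if "p \<in> {0<..} \<times> {0<..} \<and> bertrand_map c1 c2 k1 k2 p = p" for p
  proof -
    define x y where "x = sqrt (fst p)" and "y = sqrt (snd p)"
    have "x > 0" "y > 0" "p = (x\<^sup>2, y\<^sup>2)"
      using that by (auto simp: x_def y_def)
    with that show ?thesis
      using bertrand_map_fixed_iff assms by metis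
  qed
  fix p q
  assume p: "p \<in> {0<..} \<times> {0<..} \<and> bertrand_map c1 c2 k1 k2 p = p"
    and q: "q \<in> {0<..} \<times> {0<..} \<and> bertrand_map c1 c2 k1 k2 q = q"
  obtain x y where xy: "x > 0" "y > 0" "p = (x\<^sup>2, y\<^sup>2)"
    "x\<^sup>2 = c1 * (2 * (y / x) + 3)" "y\<^sup>2 = c2 * (2 * (x / y) + 3)"
    using sqrt_form[OF p] by blast
  obtain x' y' where xy': "x' > 0" "y' > 0" "q = (x'\<^sup>2, y'\<^sup>2)"
    "x'\<^sup>2 = c1 * (2 * (y' / x') + 3)" "y'\<^sup>2 = c2 * (2 * (x' / y') + 3)"
    using sqrt_form[OF q] by blast
  have ratio: "y / x = y' / x'"
    using xy xy' assms by (intro antisym ratio_le[of _ _ _ _ c1 c2]) auto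
  then have "x / y = x' / y'"
    using xy xy' by (simp add: field_simps)
  \<comment> \<open>Both prices are functions of the ratios alone, so equal ratios give equal
    prices.\<close>
  with ratio show "p = q"
    unfolding xy(3) xy'(3) xy(4,5) xy'(4,5) by simp
qed

end
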